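(* For every operator pair $(\beta,\gamma)$ the compressed Gramian blocks $\Upsilon_{st}^{(\beta,\gamma)}=\frac1{N_{\mathcal D}}(\Psi_s^{(\beta)})^\top\Psi_t^{(\gamma)}$ of the tensor-train ansatz satisfy: (1) For every $s=1,\dots,d$, $$\Upsilon_{ss}^{(\beta,\gamma)}=\frac1{n_s}I_{n_s}\otimes\big(\mathsf L_{<s}^{(\beta,\gamma)}\otimes\mathsf R_{>s}^{(\beta,\gamma)}\big)\in\mathbb R^{n_sr_{s-1}r_s\times n_sr_{s-1}r_s}.$$ (2) Let $s<t$ and fix active samples $i_s,i_t$ and bond pairs $(\alpha_{s-1},\alpha_s)$, $(\alpha'_{t-1},\alpha'_t)$. Define $$\mathsf Z_s:=\frac1{n_s}\mathsf M_{\alpha_{s-1}\alpha_s}^\top\mathsf L_{<s}^{(\beta,\gamma)}\mathsf G_s^{(\gamma)}(i_s)\in\mathbb R^{r_s\times r_s},$$ $$\mathsf Z_m:=\overset{\to}{\mathcal T}{}_m^{(\beta,\gamma)}(\mathsf Z_{m-1})\in\mathbb R^{r_m\times r_m},\qquad s<m<t,$$ $$\mathsf Z_t:=\frac1{n_t}\big(\mathsf G_t^{(\beta)}(i_t)\big)^\top\mathsf Z_{t-1}\mathsf M_{\alpha'_{t-1}\alpha'_t}\in\mathbb R^{r_t\times r_t}$$ (the middle step being absent if $t=s+1$). Then $\Upsilon_{st}^{(\beta,\gamma)}\in\mathbb R^{n_sr_{s-1}r_s\times n_tr_{t-1}r_t}$ has entries $$\Upsilon_{st}^{(\beta,\gamma)}\big(\overline{i_s\alpha_{s-1}\alpha_s},\overline{i_t\alpha'_{t-1}\alpha'_t}\big)=\big\langle\mathsf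 Z_t,\mathsf R_{>t}^{(\beta,\gamma)}\big\rangle_{\mathrm F},$$ and the opposite block is given by $\Upsilon_{ts}^{(\gamma,\beta)}=(\Upsilon_{st}^{(\beta,\gamma)})^\top$.
   Context: $\mathcal D=\mathcal D_1\times\cdots\times\mathcal D_d$ with bounded open intervals $\mathcal D_m$; $H_m\hookrightarrow L^2(\mathcal D_m)$ Hilbert spaces; TT ranks $r_0=r_d=1$, $r_m\in\mathbb N$. The tensor-train ansatz is $u_\theta(z)=G_1(z_1;\theta^1)\cdots G_d(z_d;\theta^d)$ with cores $G_m:\mathcal D_m\to\mathbb R^{r_{m-1}\times r_m}$ whose entries lie in $H_m$. The operator is $\mathcal A=\sum_{\beta=1}^{R_{\mathcal A}}\mathcal A_1^{(\beta)}\otimes\cdots\otimes\mathcal A_d^{(\beta)}$ on $H_1\otimes\cdots\otimes H_d$ with bounded linear $\mathcal A_m^{(\beta)}:H_m\to L^2(\mathcal D_m)$, applied entrywise to cores; $\mathcal A_m^{(\beta)}G_m$ has continuous entries. Factor grids $\{z_{m,1},\dots,z_{m,n_m}\}\subset\mathcal D_m$; $N_{\mathcal D}=\prod_mn_m$; sampled operated cores $\mathsf G_m^{(\beta)}(i_m)=(\mathcal A_m^{(\beta)}G_m)(z_{m,i_m})\in\mathbb R^{r_{m-1}\times r_m}$. Index convention: $\overline{i_1\ldots i_k}$ is the lexicographic position of $(i_1,\dots,i_k)$ (leftmost index slowest), and $(A\otimes B)(\overline{i_1i_2},\overline{j_1j_2})=A(i_1,j_1)B(i_2,j_2)$. $\mathsf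 M_{\alpha_{s-1}\alpha_s}=\mathrm e_{\alpha_{s-1}}\mathrm e_{\alpha_s}^\top\in\mathbb R^{r_{s-1}\times r_s}$ are the matrix units. $\langle X,Y\rangle_{\mathrm F}=\operatorname{tr}(X^\top Y)$. Direction matrices: with $i_{-s}$ the multi-index $(i_1,\dots,i_d)$ with $i_s$ removed, $$\mathsf E_s^{(\beta)}(\overline{i_{-s}},\overline{\alpha_{s-1}\alpha_s})=\big[\mathsf G_1^{(\beta)}(i_1)\cdots\mathsf G_{s-1}^{(\beta)}(i_{s-1})\big](1,\alpha_{s-1})\,\big[\mathsf G_{s+1}^{(\beta)}(i_{s+1})\cdots\mathsf G_d^{(\beta)}(i_d)\big](\alpha_s,1)$$ (empty products equal $1$), and $\Psi_s^{(\beta)}\in\mathbb R^{N_{\mathcal D}\times n_sr_{s-1}r_s}$, $\Psi_s^{(\beta)}(\overline{i_1\ldots i_d},\overline{j_s\alpha_{s-1}\alpha_s})=\delta_{i_sj_s}\mathsf E_s^{(\beta)}(\overline{i_{-s}},\overline{\alpha_{s-1}\alpha_s})$. Transfers and interfaces: $$\overset{\to}{\mathcal T}{}_m^{(\beta,\gamma)}(X)=\frac1{n_m}\sum_{j=1}^{n_m}\mathsf G_m^{(\beta)}(j)^\top X\,\mathsf G_m^{(\gamma)}(j),\qquad \overset{\leftarrow}{\mathcal T}{}_m^{(\beta,\gamma)}(Y)=\frac1{n_m}\sum_{j=1}^{n_m}\mathsf G_m^{(\beta)}(j)\,Y\,\mathsf G_m^{(\gamma)}(j)^\top,$$ for $X\in\mathbb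 R^{r_{m-1}\times r_{m-1}}$, $Y\in\mathbb R^{r_m\times r_m}$. The left and right interfaces are defined by $\mathsf L_{<1}^{(\beta,\gamma)}=1$, $\mathsf L_{<m+1}^{(\beta,\gamma)}=\overset{\to}{\mathcal T}{}_m^{(\beta,\gamma)}(\mathsf L_{<m}^{(\beta,\gamma)})$ for $m=1,\dots,d-1$, and $\mathsf R_{>d}^{(\beta,\gamma)}=1$, $\mathsf R_{>m-1}^{(\beta,\gamma)}=\overset{\leftarrow}{\mathcal T}{}_m^{(\beta,\gamma)}(\mathsf R_{>m}^{(\beta,\gamma)})$ for $m=d,\dots,2$; equivalently $\mathsf L_{<s}^{(\beta,\gamma)}=\frac1{N_{<s}}(\mathsf U_{<s}^{(\beta)})^\top\mathsf U_{<s}^{(\gamma)}$ and $\mathsf R_{>s}^{(\beta,\gamma)}=\frac1{N_{>s}}(\mathsf U_{>s}^{(\beta)})^\top\mathsf U_{>s}^{(\gamma)}$, where $N_{<s}=\prod_{m<s}n_m$, $N_{>s}=\prod_{m>s}n_m$, and $\mathsf U_{<s}^{(\beta)}\in\mathbb R^{N_{<s}\times r_{s-1}}$, $\mathsf U_{>s}^{(\beta)}\in\mathbb R^{N_{>s}\times r_s}$ have rows $\mathsf G_1^{(\beta)}(i_1)\cdots\mathsf G_{s-1}^{(\beta)}(i_{s-1})$ and $[\mathsf G_{s+1}^{(\beta)}(i_{s+1})\cdots\mathsf G_d^{(\beta)}(i_d)]^\top$ respectively. *)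

theory Defs
  imports
    "HOL-Analysis.Lebesgue_Measure"
    "HOL-Analysis.Bochner_Integration"
    "Jordan_Normal_Form.Matrix"
begin

text \<open>
  Conventions. Modes \<open>m\<close>, \<open>s\<close>, \<open>t\<close> and operator terms \<open>\<beta>\<close>, \<open>\<gamma>\<close> are counted from 1, with
  TT ranks \<open>r m\<close> and grid sizes \<open>n m\<close>. Everything that indexes
  a row or column of a matrix (samples, bond indices, positions of multi-indices) is counted
  from 0, as for the type of matrices used here.
\<close>

text \<open>
  An element of \<open>L\<^sup>2(D)\<close> is given by a representative; equality in \<open>L\<^sup>2(D)\<close> is equality almost
  everywhere on \<open>D\<close>. The mode spaces \<open>H\<^sub>1, \<dots>, H\<^sub>d\<close> are taken as complete subspaces of one ambient
  inner product space; this is no restriction, since any Hilbert spaces embed isometrically in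
  their direct sum.
\<close>

definition L2_fun :: "real set \<Rightarrow> (real \<Rightarrow> real) set" where
  "L2_fun D = {f \<in> borel_measurable (lebesgue_on D). integrable (lebesgue_on D) (\<lambda>x. (f x)\<^sup>2)}"

definition L2_norm :: "real set \<Rightarrow> (real \<Rightarrow> real) \<Rightarrow> real" where
  "L2_norm D f = sqrt (integral\<^sup>L (lebesgue_on D) (\<lambda>x. (f x)\<^sup>2))"

definition bounded_linear_L2 :: "'h::real_normed_vector set \<Rightarrow> real set \<Rightarrow> ('h \<Rightarrow> real \<Rightarrow> real) \<Rightarrow> bool" where
  "bounded_linear_L2 V D T \<longleftrightarrow>
     (\<forall>x\<in>V. T x \<in> L2_fun D) \<and>
     (\<forall>x\<in>V. \<forall>y\<in>V. AE z in lebesgue_on D. T (x + y) z = T x z + T y z) \<and>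
     (\<forall>c. \<forall>x\<in>V. AE z in lebesgue_on D. T (c *\<^sub>R x) z = c * T x z) \<and>
     (\<exists>C. \<forall>x\<in>V. L2_norm D (T x) \<le> C * norm x)"

definition L2_embedding :: "'h::real_normed_vector set \<Rightarrow> real set \<Rightarrow> ('h \<Rightarrow> real \<Rightarrow> real) \<Rightarrow> bool" where
  "L2_embedding V D T \<longleftrightarrow>
     bounded_linear_L2 V D T \<and> (\<forall>x\<in>V. (AE z in lebesgue_on D. T x z = 0) \<longrightarrow> x = 0)"

definition is_cont_rep :: "real set \<Rightarrow> (real \<Rightarrow> real) \<Rightarrow> (real \<Rightarrow> real) \<Rightarrow> bool" where
  "is_cont_rep D f g \<longleftrightarrow> continuous_on D g \<and> (AE z in lebesgue_on D. f z = g z)"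

text \<open>
  Point evaluation of an element of \<open>L\<^sup>2(D)\<close> means evaluation of its continuous representative,
  whose values on an open \<open>D\<close> are determined by the class.
\<close>

definition cont_rep :: "real set \<Rightarrow> (real \<Rightarrow> real) \<Rightarrow> real \<Rightarrow> real" where
  "cont_rep D f = (SOME g. is_cont_rep D f g)"

lemma is_cont_rep_unique:
  assumes "open D" "is_cont_rep D f g" "is_cont_rep D f h" "x \<in> D"
  shows "g x = h x"
proof (rule ccontr)
  assume neq: "g x \<noteq> h x"
  have c: "continuous_on D (\<lambda>z. g z - h z)"
    using assms by (auto simp: is_cont_rep_def intro: continuous_intros)
  define S where "S = (\<lambda>z. g z - h z) -` (- {0}) \<inter> D"
  have S: "open S" unfolding S_def
    using c assms(1) by (auto simp: continuous_on_open_vimage)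
  have "AE z in lebesgue_on D. g z = h z"
    using assms(2,3) unfolding is_cont_rep_def by auto
  hence "AE z in lebesgue. z \<in> D \<longrightarrow> g z = h z"
    using assms(1) by (subst (asm) AE_restrict_space_iff) auto
  hence "AE z\<in>S in lebesgue. z \<in> {}"
    by eventually_elim (auto simp: S_def)
  moreover have "x \<in> S" using neq assms(4) by (auto simp: S_def)
  ultimately show False
    using mem_closed_if_AE_lebesgue_open[OF S closed_empty] by blast
qed

lemma cont_rep_eq:
  assumes "open D" "is_cont_rep D f g" "x \<in> D"
  shows "cont_rep D f x = g x"
  using is_cont_rep_unique[OF assms(1) someI[of "is_cont_rep D f", OF assms(2)] assms(2,3)]
  by (simp add: cont_rep_def)

text \<open>
  \<open>lex_pos ns is\<close> is the lexicographic position (leftmost index slowest) of the multi-index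
  \<open>is\<close> in the box with side lengths \<open>ns\<close>, and \<open>lex_index ns\<close> is its inverse.
\<close>

fun lex_pos :: "nat list \<Rightarrow> nat list \<Rightarrow> nat" where
  "lex_pos (n # ns) (i # is) = i * prod_list ns + lex_pos ns is"
| "lex_pos _ _ = 0"

fun lex_index :: "nat list \<Rightarrow> nat \<Rightarrow> nat list" where
  "lex_index [] p = []"
| "lex_index (n # ns) p = (p div prod_list ns) # lex_index ns (p mod prod_list ns)"

lemma lex_pos_less: "list_all2 (<) is ns \<Longrightarrow> lex_pos ns is < prod_list ns"
proof (induction rule: list_all2_induct)
  case (Cons i "is" n ns)
  have "i * prod_list ns + lex_pos ns is < Suc i * prod_list ns" using Cons by simp
  also have "\<dots> \<le> n * prod_list ns" using Cons(1) by (intro mult_right_mono) auto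
  finally show ?case by simp
qed simp

lemma lex_index_lex_pos: "list_all2 (<) is ns \<Longrightarrow> lex_index ns (lex_pos ns is) = is"
  by (induction rule: list_all2_induct) (auto dest: lex_pos_less)

lemma lex_pos_lex_index: "p < prod_list ns \<Longrightarrow> lex_pos ns (lex_index ns p) = p"
proof (induction ns arbitrary: p)
  case (Cons n ns)
  hence "prod_list ns > 0" by (metis gr_zeroI mult_is_0 not_less_zero prod_list.Cons)
  thus ?case using Cons.IH[of "p mod prod_list ns"] by simp
qed simp

lemma lex_index_box: "p < prod_list ns \<Longrightarrow> list_all2 (<) (lex_index ns p) ns"
proof (induction ns arbitrary: p)
  case (Cons n ns)
  hence "prod_list ns > 0" by (metis gr_zeroI mult_is_0 not_less_zero prod_list.Cons)
  thus ?case using Cons by (simp add: less_mult_imp_div_less)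
qed simp

text \<open>\<open>omit s xs\<close> drops the entry belonging to mode \<open>s\<close>.\<close>

definition omit :: "nat \<Rightarrow> 'a list \<Rightarrow> 'a list" where
  "omit s xs = take (s - 1) xs @ drop s xs"

definition grid_dims :: "nat \<Rightarrow> (nat \<Rightarrow> nat) \<Rightarrow> nat list" where
  "grid_dims d n = map n [1..<Suc d]"

definition kronecker :: "real mat \<Rightarrow> real mat \<Rightarrow> real mat" where
  "kronecker A B = mat (dim_row A * dim_row B) (dim_col A * dim_col B)
     (\<lambda>(p, q). A $$ (p div dim_row B, q div dim_col B) * B $$ (p mod dim_row B, q mod dim_col B))"

lemma kronecker_entry:
  assumes "i1 < dim_row A" "i2 < dim_row B" "j1 < dim_col A" "j2 < dim_col B"
  shows "kronecker A B $$ (lex_pos [dim_row A, dim_row B] [i1, i2], lex_pos [dim_col A, dim_col B] [j1, j2])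
    = A $$ (i1, j1) * B $$ (i2, j2)"
  using lex_pos_less[of "[i1, i2]" "[dim_row A, dim_row B]"]
    lex_pos_less[of "[j1, j2]" "[dim_col A, dim_col B]"] assms
  by (simp add: kronecker_def)

definition mat_trace :: "real mat \<Rightarrow> real" where
  "mat_trace A = (\<Sum>i<dim_row A. A $$ (i, i))"

definition frobenius :: "real mat \<Rightarrow> real mat \<Rightarrow> real" where
  "frobenius X Y = mat_trace (X\<^sup>T * Y)"

definition mat_unit :: "nat \<Rightarrow> nat \<Rightarrow> nat \<Rightarrow> nat \<Rightarrow> real mat" where
  "mat_unit p q a b = mat_of_cols p [unit_vec p a] * mat_of_rows q [unit_vec q b]"

text \<open>
  \<open>core m a b\<close> is the \<open>(a, b)\<close> entry of the core \<open>G\<^sub>m\<close>, an element of the \<open>m\<close>-th Hilbert space,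
  and \<open>Op \<beta> m\<close> is the \<open>m\<close>-th factor of the \<open>\<beta>\<close>-th operator term.
\<close>

definition sampled_core ::
  "(nat \<Rightarrow> nat) \<Rightarrow> (nat \<Rightarrow> real set) \<Rightarrow> (nat \<Rightarrow> nat \<Rightarrow> 'h \<Rightarrow> real \<Rightarrow> real) \<Rightarrow>
   (nat \<Rightarrow> nat \<Rightarrow> nat \<Rightarrow> 'h) \<Rightarrow> (nat \<Rightarrow> nat \<Rightarrow> real) \<Rightarrow> nat \<Rightarrow> nat \<Rightarrow> nat \<Rightarrow> real mat" where
  "sampled_core r D Op core z \<beta> m i =
     mat (r (m - 1)) (r m) (\<lambda>(a, b). cont_rep (D m) (Op \<beta> m (core m a b)) (z m i))"

text \<open>
  In the following, \<open>G m i\<close> stands for the sampled core of mode \<open>m\<close> at sample \<open>i\<close>, for one fixed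
  operator term; where two of them occur, they belong to \<open>\<beta>\<close> and \<open>\<gamma>\<close>, in this order.
  \<open>core_prod r G m [i\<^sub>m, i\<^sub>m\<^sub>+\<^sub>1, \<dots>]\<close> is the product \<open>G m i\<^sub>m * G (m + 1) i\<^sub>m\<^sub>+\<^sub>1 * \<dots>\<close>.
\<close>

type_synonym cores = "nat \<Rightarrow> nat \<Rightarrow> real mat"

fun core_prod :: "(nat \<Rightarrow> nat) \<Rightarrow> cores \<Rightarrow> nat \<Rightarrow> nat list \<Rightarrow> real mat" where
  "core_prod r G m [] = 1\<^sub>m (r (m - 1))"
| "core_prod r G m (i # is) = G m i * core_prod r G (Suc m) is"

definition direction_mat ::
  "nat \<Rightarrow> (nat \<Rightarrow> nat) \<Rightarrow> (nat \<Rightarrow> nat) \<Rightarrow> cores \<Rightarrow> nat \<Rightarrow> real mat" where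
  "direction_mat d r n G s =
     mat (prod_list (omit s (grid_dims d n))) (r (s - 1) * r s)
       (\<lambda>(p, q). let k = lex_index (omit s (grid_dims d n)) p; \<alpha> = lex_index [r (s - 1), r s] q in
          core_prod r G 1 (take (s - 1) k) $$ (0, \<alpha> ! 0) *
          core_prod r G (s + 1) (drop (s - 1) k) $$ (\<alpha> ! 1, 0))"

definition Psi ::
  "nat \<Rightarrow> (nat \<Rightarrow> nat) \<Rightarrow> (nat \<Rightarrow> nat) \<Rightarrow> cores \<Rightarrow> nat \<Rightarrow> real mat" where
  "Psi d r n G s =
     mat (\<Prod>m=1..d. n m) (n s * r (s - 1) * r s)
       (\<lambda>(p, q). let i = lex_index (grid_dims d n) p; c = lex_index [n s, r (s - 1), r s] q in
          if i ! (s - 1) = c ! 0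
          then direction_mat d r n G s $$
                 (lex_pos (omit s (grid_dims d n)) (omit s i), lex_pos [r (s - 1), r s] [c ! 1, c ! 2])
          else 0)"

definition Upsilon ::
  "nat \<Rightarrow> (nat \<Rightarrow> nat) \<Rightarrow> (nat \<Rightarrow> nat) \<Rightarrow> cores \<Rightarrow> cores \<Rightarrow> nat \<Rightarrow> nat \<Rightarrow> real mat" where
  "Upsilon d r n G\<beta> G\<gamma> s t =
     (1 / real (\<Prod>m=1..d. n m)) \<cdot>\<^sub>m ((Psi d r n G\<beta> s)\<^sup>T * Psi d r n G\<gamma> t)"

definition mat_avg :: "nat \<Rightarrow> nat \<Rightarrow> (nat \<Rightarrow> real mat) \<Rightarrow> real mat" where
  "mat_avg k n F = mat k k (\<lambda>(a, b). 1 / real n * (\<Sum>j<n. F j $$ (a, b)))"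

definition transfer_right ::
  "(nat \<Rightarrow> nat) \<Rightarrow> (nat \<Rightarrow> nat) \<Rightarrow> cores \<Rightarrow> cores \<Rightarrow> nat \<Rightarrow> real mat \<Rightarrow> real mat" where
  "transfer_right r n G\<beta> G\<gamma> m X = mat_avg (r m) (n m) (\<lambda>j. (G\<beta> m j)\<^sup>T * X * G\<gamma> m j)"

definition transfer_left ::
  "(nat \<Rightarrow> nat) \<Rightarrow> (nat \<Rightarrow> nat) \<Rightarrow> cores \<Rightarrow> cores \<Rightarrow> nat \<Rightarrow> real mat \<Rightarrow> real mat" where
  "transfer_left r n G\<beta> G\<gamma> m Y = mat_avg (r (m - 1)) (n m) (\<lambda>j. G\<beta> m j * Y * (G\<gamma> m j)\<^sup>T)"

text \<open>
  The auxiliary recursions count the modes already absorbed: \<open>left_steps k\<close> has absorbed the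
  modes \<open>1, \<dots>, k\<close>, and \<open>right_steps k\<close> the modes \<open>d, d - 1, \<dots>, d - k + 1\<close>.
\<close>

primrec left_steps ::
  "(nat \<Rightarrow> nat) \<Rightarrow> (nat \<Rightarrow> nat) \<Rightarrow> cores \<Rightarrow> cores \<Rightarrow> nat \<Rightarrow> real mat" where
  "left_steps r n G\<beta> G\<gamma> 0 = 1\<^sub>m 1"
| "left_steps r n G\<beta> G\<gamma> (Suc k) = transfer_right r n G\<beta> G\<gamma> (Suc k) (left_steps r n G\<beta> G\<gamma> k)"

definition L_lt :: "(nat \<Rightarrow> nat) \<Rightarrow> (nat \<Rightarrow> nat) \<Rightarrow> cores \<Rightarrow> cores \<Rightarrow> nat \<Rightarrow> real mat" where
  "L_lt r n G\<beta> G\<gamma> m = left_steps r n G\<beta> G\<gamma> (m - 1)"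

primrec right_steps ::
  "nat \<Rightarrow> (nat \<Rightarrow> nat) \<Rightarrow> (nat \<Rightarrow> nat) \<Rightarrow> cores \<Rightarrow> cores \<Rightarrow> nat \<Rightarrow> real mat" where
  "right_steps d r n G\<beta> G\<gamma> 0 = 1\<^sub>m 1"
| "right_steps d r n G\<beta> G\<gamma> (Suc k) = transfer_left r n G\<beta> G\<gamma> (d - k) (right_steps d r n G\<beta> G\<gamma> k)"

definition R_gt ::
  "nat \<Rightarrow> (nat \<Rightarrow> nat) \<Rightarrow> (nat \<Rightarrow> nat) \<Rightarrow> cores \<Rightarrow> cores \<Rightarrow> nat \<Rightarrow> real mat" where
  "R_gt d r n G\<beta> G\<gamma> m = right_steps d r n G\<beta> G\<gamma> (d - m)"

lemma L_lt_1: "L_lt r n G\<beta> G\<gamma> 1 = 1\<^sub>m 1"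
  by (simp add: L_lt_def)

lemma L_lt_step: "m \<ge> 1 \<Longrightarrow> L_lt r n G\<beta> G\<gamma> (m + 1) = transfer_right r n G\<beta> G\<gamma> m (L_lt r n G\<beta> G\<gamma> m)"
  by (cases m) (simp_all add: L_lt_def)

lemma R_gt_d: "R_gt d r n G\<beta> G\<gamma> d = 1\<^sub>m 1"
  by (simp add: R_gt_def)

lemma R_gt_step:
  assumes "1 \<le> m" "m \<le> d"
  shows "R_gt d r n G\<beta> G\<gamma> (m - 1) = transfer_left r n G\<beta> G\<gamma> m (R_gt d r n G\<beta> G\<gamma> m)"
proof -
  have "d - (m - 1) = Suc (d - m)" "d - (d - m) = m" using assms by auto
  thus ?thesis by (simp add: R_gt_def)
qed

end

theory Submission
  imports Defs
begin

text \<open>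
  A column of \<open>\<Psi>\<^sub>s\<close> with index \<open>(j, a, b)\<close> is itself a sampled tensor train: replace the core at
  mode \<open>s\<close> by the matrix unit \<open>M\<^sub>a\<^sub>b\<close> at sample \<open>j\<close> and by zero at all other samples. An entry of
  \<open>\<Upsilon>\<^sub>s\<^sub>t\<close> is therefore the mean over the grid of a product of two tensor trains, which is the right
  interface of the modified cores with all modes absorbed. As the two transfers at a mode are
  adjoint for the Frobenius product, this number equals the Frobenius product of the left and the
  right interface of the modified cores at any bond. At bond \<open>t\<close> the right interface is the
  original one, and the modified left recursion runs through \<open>L\<^sub>s, Z\<^sub>s, \<dots>, Z\<^sub>t\<close>. At \<open>s = t\<close> its
  last step is \<open>M\<^sup>T L\<^sub>s M' / n\<^sub>s\<close> for matrix units \<open>M\<close>, \<open>M'\<close>, or zero if the active samples differ.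
\<close>

section \<open>Sums over lexicographic positions\<close>

text \<open>Division with remainder by \<open>k > 0\<close> is a bijection from the positions below
  \<open>n * k\<close> to the pairs; for \<open>k = 0\<close> both sides vanish.\<close>

lemma sum_div_mod:
  fixes f :: "nat \<Rightarrow> nat \<Rightarrow> 'a::comm_monoid_add"
  shows "(\<Sum>p<n * k. f (p div k) (p mod k)) = (\<Sum>i<n. \<Sum>q<k. f i q)"
proof (cases "k = 0")
  case False
  have "(\<Sum>p<n * k. f (p div k) (p mod k)) = (\<Sum>(i, q)\<in>{..<n} \<times> {..<k}. f i q)"
  proof (rule sum.reindex_bij_witness[where i = "\<lambda>(i, q). i * k + q" and j = "\<lambda>p. (p div k, p mod k)"])
    fix x assume "x \<in> {..<n} \<times> {..<k}"
    then obtain i q where x: "x = (i, q)" "i < n" "q < k" by auto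
    have "i * k + q < Suc i * k" using x by simp
    also have "\<dots> \<le> n * k" using x by (intro mult_right_mono) auto
    finally show "(case x of (i, q) \<Rightarrow> i * k + q) \<in> {..<n * k}" using x by simp
  qed (use False in \<open>auto simp: less_mult_imp_div_less\<close>)
  thus ?thesis by (simp add: sum.cartesian_product)
qed simp

text \<open>Splits off the slowest index of a grid sum, matching the absorption of one further mode
  on the left by the right interface.\<close>

lemma sum_lex_index_Cons:
  fixes f :: "nat list \<Rightarrow> 'a::comm_monoid_add"
  shows "(\<Sum>p<prod_list (n # ns). f (lex_index (n # ns) p)) =
    (\<Sum>i<n. \<Sum>p<prod_list ns. f (i # lex_index ns p))"
  using sum_div_mod[of "\<lambda>i p. f (i # lex_index ns p)" "prod_list ns" n] by simp

lemma length_lex_index [simp]: "length (lex_index ns p) = length ns"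
  by (induction ns arbitrary: p) auto

section \<open>Entries of matrix products, Frobenius products and matrix units\<close>

lemma mult_entry:
  fixes A B :: "real mat"
  assumes "A \<in> carrier_mat p q" "B \<in> carrier_mat q w" "i < p" "j < w"
  shows "(A * B) $$ (i, j) = (\<Sum>k<q. A $$ (i, k) * B $$ (k, j))"
  using assms by (auto simp: scalar_prod_def lessThan_atLeast0)

lemma mult3_entry:
  fixes A X B :: "real mat"
  assumes "A \<in> carrier_mat p q" "X \<in> carrier_mat q q'" "B \<in> carrier_mat q' w" "i < p" "j < w"
  shows "(A * X * B) $$ (i, j) = (\<Sum>k<q. \<Sum>l<q'. A $$ (i, k) * X $$ (k, l) * B $$ (l, j))"
proof -
  have "(A * X * B) $$ (i, j) = (\<Sum>l<q'. (\<Sum>k<q. A $$ (i, k) * X $$ (k, l)) * B $$ (l, j))"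
    using assms by (subst mult_entry[of _ p q' _ w]) (auto simp: mult_entry[of _ p q _ q'] simp del: index_mult_mat(1) intro!: sum.cong)
  also have "\<dots> = (\<Sum>k<q. \<Sum>l<q'. A $$ (i, k) * X $$ (k, l) * B $$ (l, j))"
    by (simp add: sum_distrib_right) (rule sum.swap)
  finally show ?thesis .
qed

lemma frobenius_entries:
  assumes "X \<in> carrier_mat p q" "Y \<in> carrier_mat p q"
  shows "frobenius X Y = (\<Sum>i<p. \<Sum>j<q. X $$ (i, j) * Y $$ (i, j))"
proof -
  have "frobenius X Y = (\<Sum>j<q. \<Sum>i<p. X $$ (i, j) * Y $$ (i, j))"
    using assms unfolding frobenius_def mat_trace_def
    by (intro sum.cong) (auto simp: mult_entry[of _ q p _ q] simp del: index_mult_mat(1))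
  thus ?thesis by (subst sum.swap)
qed

lemma mat_unit_carrier [simp]: "mat_unit p q a b \<in> carrier_mat p q"
  unfolding mat_unit_def by (rule mult_carrier_mat[of _ p 1]) (auto simp: carrier_matI)

lemma dim_mat_unit [simp]: "dim_row (mat_unit p q a b) = p" "dim_col (mat_unit p q a b) = q"
  using mat_unit_carrier[of p q a b] by (auto simp del: mat_unit_carrier)

lemma mat_unit_entry:
  assumes "a < p" "b < q" "i < p" "j < q"
  shows "mat_unit p q a b $$ (i, j) = of_bool (i = a) * of_bool (j = b)"
  using assms unfolding mat_unit_def
  by (subst mult_entry[of _ p 1 _ q]) (auto simp: mat_of_cols_def mat_of_rows_def carrier_matI)

section \<open>Shapes and products of tensor-train cores\<close>

text \<open>The shape is required at all modes and samples, also outside the grid, so that no range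
  conditions have to be carried along. Sampled cores satisfy it because \<open>sampled_core\<close>
  fixes the dimensions for every argument.\<close>

definition tt_cores :: "(nat \<Rightarrow> nat) \<Rightarrow> cores \<Rightarrow> bool" where
  "tt_cores r G \<longleftrightarrow> (\<forall>m i. G m i \<in> carrier_mat (r (m - 1)) (r m))"

lemma tt_coresD: "tt_cores r G \<Longrightarrow> G m i \<in> carrier_mat (r (m - 1)) (r m)"
  by (simp add: tt_cores_def)

text \<open>Starting at \<open>Suc m\<close> makes the row dimension \<open>r m\<close>, free of
  truncated subtraction, and lets the induction shift \<open>m\<close>.\<close>

lemma core_prod_carrier:
  assumes "tt_cores r G"
  shows "core_prod r G (Suc m) is \<in> carrier_mat (r m) (r (m + length is))"
proof (induction "is" arbitrary: m)
  case (Cons i "is")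
  show ?case using tt_coresD[OF assms, of "Suc m" i] Cons[of "Suc m"] by simp
qed simp

lemma core_prod_append:
  assumes "tt_cores r G"
  shows "core_prod r G (Suc m) (is @ js) =
    core_prod r G (Suc m) is * core_prod r G (Suc (m + length is)) js"
proof (induction "is" arbitrary: m)
  case Nil
  show ?case using core_prod_carrier[OF assms, of m js] by simp
next
  case (Cons i "is")
  show ?case
    using tt_coresD[OF assms, of "Suc m" i] core_prod_carrier[OF assms, of "Suc m" "is"]
      core_prod_carrier[OF assms, of "Suc (m + length is)" js] Cons[of "Suc m"]
    by (simp add: assoc_mult_mat)
qed

lemma core_prod_cong:
  assumes "\<And>k. m \<le> k \<Longrightarrow> k < m + length is \<Longrightarrow> G k = G' k"
  shows "core_prod r G m is = core_prod r G' m is"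
  using assms by (induction "is" arbitrary: m) auto

section \<open>Shapes and locality of transfers and interfaces\<close>

lemma transfer_right_carrier [simp]: "transfer_right r n G G' m X \<in> carrier_mat (r m) (r m)"
  by (simp add: transfer_right_def mat_avg_def)

lemma transfer_left_carrier [simp]: "transfer_left r n G G' m Y \<in> carrier_mat (r (m - 1)) (r (m - 1))"
  by (simp add: transfer_left_def mat_avg_def)

lemma left_steps_carrier:
  assumes "r 0 = 1"
  shows "left_steps r n G G' k \<in> carrier_mat (r k) (r k)"
  using assms by (cases k) auto

lemma right_steps_carrier:
  assumes "r d = 1" "k \<le> d"
  shows "right_steps d r n G G' k \<in> carrier_mat (r (d - k)) (r (d - k))"
proof (cases k)
  case (Suc j)
  thus ?thesis using transfer_left_carrier[of r n G G' "d - j"] by simp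
qed (use assms in simp)

lemma L_lt_carrier: "r 0 = 1 \<Longrightarrow> L_lt r n G G' m \<in> carrier_mat (r (m - 1)) (r (m - 1))"
  unfolding L_lt_def by (rule left_steps_carrier)

lemma R_gt_carrier: "r d = 1 \<Longrightarrow> m \<le> d \<Longrightarrow> R_gt d r n G G' m \<in> carrier_mat (r m) (r m)"
  using right_steps_carrier[of r d "d - m" n G G'] by (simp add: R_gt_def)

text \<open>Locality: an interface depends only on the cores it has absorbed. This identifies
  interfaces of modified cores with the original ones up to the modified modes.\<close>

lemma left_steps_cong:
  assumes "\<And>m. m \<le> k \<Longrightarrow> G m = F m" "\<And>m. m \<le> k \<Longrightarrow> G' m = F' m"
  shows "left_steps r n G G' k = left_steps r n F F' k"
  using assms by (induction k) (auto simp: transfer_right_def)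

lemma right_steps_cong:
  assumes "k \<le> d" "\<And>m. d - k < m \<Longrightarrow> G m = F m" "\<And>m. d - k < m \<Longrightarrow> G' m = F' m"
  shows "right_steps d r n G G' k = right_steps d r n F F' k"
  using assms
proof (induction k)
  case (Suc k)
  hence "right_steps d r n G G' k = right_steps d r n F F' k" by simp
  moreover have "G (d - k) = F (d - k)" "G' (d - k) = F' (d - k)" using Suc by auto
  ultimately show ?case by (simp add: transfer_left_def)
qed simp

section \<open>Adjointness of the transfers\<close>

lemma transfer_right_entry:
  assumes "tt_cores r G" "tt_cores r G'" "X \<in> carrier_mat (r (m - 1)) (r (m - 1))" "a < r m" "b < r m"
  shows "transfer_right r n G G' m X $$ (a, b) = 1 / real (n m) *
    (\<Sum>j<n m. \<Sum>k<r (m - 1). \<Sum>l<r (m - 1). G m j $$ (k, a) * X $$ (k, l) * G' m j $$ (l, b))"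
proof -
  have "((G m j)\<^sup>T * X * G' m j) $$ (a, b) =
      (\<Sum>k<r (m - 1). \<Sum>l<r (m - 1). G m j $$ (k, a) * X $$ (k, l) * G' m j $$ (l, b))" for j
    using assms tt_coresD[OF assms(1), of m j] tt_coresD[OF assms(2), of m j]
    by (subst mult3_entry[of _ "r m" "r (m - 1)" _ "r (m - 1)" _ "r m"]) (auto intro!: sum.cong)
  thus ?thesis using assms by (simp add: transfer_right_def mat_avg_def)
qed

lemma transfer_left_entry:
  assumes "tt_cores r G" "tt_cores r G'" "Y \<in> carrier_mat (r m) (r m)" "a < r (m - 1)" "b < r (m - 1)"
  shows "transfer_left r n G G' m Y $$ (a, b) = 1 / real (n m) *
    (\<Sum>j<n m. \<Sum>k<r m. \<Sum>l<r m. G m j $$ (a, k) * Y $$ (k, l) * G' m j $$ (b, l))"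
proof -
  have "(G m j * Y * (G' m j)\<^sup>T) $$ (a, b) =
      (\<Sum>k<r m. \<Sum>l<r m. G m j $$ (a, k) * Y $$ (k, l) * G' m j $$ (b, l))" for j
    using assms tt_coresD[OF assms(1), of m j] tt_coresD[OF assms(2), of m j]
    by (subst mult3_entry[of _ "r (m - 1)" "r m" _ "r m" _ "r (m - 1)"]) (auto intro!: sum.cong)
  thus ?thesis using assms by (simp add: transfer_left_def mat_avg_def)
qed

text \<open>Sample by sample this is cyclicity of the trace: tr((A^T X B)^T Y) = tr(X^T A Y B^T). It
  is carried out by exchanging finite sums.\<close>

lemma transfer_adjoint:
  assumes "tt_cores r G" "tt_cores r G'"
    and "X \<in> carrier_mat (r (m - 1)) (r (m - 1))" "Y \<in> carrier_mat (r m) (r m)"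
  shows "frobenius (transfer_right r n G G' m X) Y = frobenius X (transfer_left r n G G' m Y)"
proof -
  define q w where "q = r (m - 1)" and "w = r m"
  let ?f = "\<lambda>a b j k l. 1 / real (n m) * (G m j $$ (k, a) * X $$ (k, l) * G' m j $$ (l, b) * Y $$ (a, b))"
  have "frobenius (transfer_right r n G G' m X) Y =
      (\<Sum>a<w. \<Sum>b<w. \<Sum>j<n m. \<Sum>k<q. \<Sum>l<q. ?f a b j k l)"
    using assms by (simp add: frobenius_entries[of _ w w] transfer_right_entry sum_distrib_left
        sum_distrib_right mult.assoc q_def w_def)
  \<comment> \<open>Flattening to one sum over a product set makes the reordering of all five
    indices a single bijection.\<close>
  also have "\<dots> = (\<Sum>(a, b, j, k, l)\<in>{..<w} \<times> {..<w} \<times> {..<n m} \<times> {..<q} \<times> {..<q}. ?f a b j k l)"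
    by (simp add: sum.cartesian_product case_prod_beta)
  also have "\<dots> = (\<Sum>(k, l, j, a, b)\<in>{..<q} \<times> {..<q} \<times> {..<n m} \<times> {..<w} \<times> {..<w}. ?f a b j k l)"
    by (rule sum.reindex_bij_witness[where i = "\<lambda>(k, l, j, a, b). (a, b, j, k, l)"
          and j = "\<lambda>(a, b, j, k, l). (k, l, j, a, b)"]) auto
  also have "\<dots> = (\<Sum>k<q. \<Sum>l<q. \<Sum>j<n m. \<Sum>a<w. \<Sum>b<w. ?f a b j k l)"
    by (simp add: sum.cartesian_product case_prod_beta)
  also have "\<dots> = frobenius X (transfer_left r n G G' m Y)"
    using assms by (simp add: frobenius_entries[of _ q q] transfer_left_entry sum_distrib_left
        mult_ac q_def w_def del: One_nat_def)
  finally show ?thesis .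
qed

text \<open>By adjointness, moving one mode from the right interface to the left one preserves the
  product. At bond 0 the left interface is the 1 by 1 identity, which leaves the single entry of the
  full right interface.\<close>

lemma frobenius_interfaces:
  assumes "tt_cores r G" "tt_cores r G'" "r 0 = 1" "r d = 1" "k \<le> d"
  shows "frobenius (left_steps r n G G' k) (right_steps d r n G G' (d - k)) =
    right_steps d r n G G' d $$ (0, 0)"
  using \<open>k \<le> d\<close>
proof (induction k)
  case 0
  have "right_steps d r n G G' d \<in> carrier_mat 1 1"
    using right_steps_carrier[of r d d n G G'] assms by simp
  thus ?case by (simp add: frobenius_entries[of _ 1 1])
next
  case (Suc k)
  have d: "d - k = Suc (d - Suc k)" "d - (d - Suc k) = Suc k" using Suc by auto
  have "frobenius (left_steps r n G G' (Suc k)) (right_steps d r n G G' (d - Suc k)) =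
      frobenius (left_steps r n G G' k)
        (transfer_left r n G G' (Suc k) (right_steps d r n G G' (d - Suc k)))"
    using assms Suc.prems right_steps_carrier[of r d "d - Suc k" n G G']
    by (simp add: transfer_adjoint left_steps_carrier)
  thus ?case using Suc by (simp add: d)
qed

section \<open>Right interfaces as means over the grid\<close>

text \<open>Unrolls the recursion into the Gram form (1/N) U^T U, where U has the partial core
  products as rows. The bond indices stay general because the induction step sums over them; column
  0 is the only one, since \<open>r d = 1\<close>.\<close>

lemma right_steps_entry:
  fixes n :: "nat \<Rightarrow> nat"
  assumes "tt_cores r G" "tt_cores r G'" "r d = 1" "k \<le> d" "a < r (d - k)" "b < r (d - k)"
  defines "ns \<equiv> (\<lambda>k. map n [Suc (d - k)..<Suc d])"
  shows "right_steps d r n G G' k $$ (a, b) = 1 / real (prod_list (ns k)) *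
    (\<Sum>p<prod_list (ns k). core_prod r G (Suc (d - k)) (lex_index (ns k) p) $$ (a, 0) *
       core_prod r G' (Suc (d - k)) (lex_index (ns k) p) $$ (b, 0))"
  using assms(4-6)
proof (induction k arbitrary: a b)
  case 0
  thus ?case using \<open>r d = 1\<close> by (simp add: ns_def)
next
  case (Suc k)
  \<comment> \<open>Step \<open>Suc k\<close> absorbs mode \<open>d - k\<close>; the first
    \<open>k\<close> steps have absorbed the modes beyond it.\<close>
  define m where "m = d - k"
  define P where "P = prod_list (ns k)"
  have m: "d - Suc k = m - 1" "Suc (m - 1) = m" "m \<le> d" "m > 0" using Suc by (auto simp: m_def)
  have ab: "a < r (m - 1)" "b < r (m - 1)" using Suc m by auto
  have ns: "ns (Suc k) = n m # ns k"
    using m upt_conv_Cons[of m "Suc d"] by (simp add: ns_def del: upt_Suc flip: m_def)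
  have len: "length (ns k) = d - m" by (simp add: ns_def m_def del: upt_Suc)
  let ?c = "\<lambda>G p. core_prod r G (Suc m) (lex_index (ns k) p)"
  have carr: "?c F p \<in> carrier_mat (r m) 1" if "tt_cores r F" for F p
    using core_prod_carrier[OF that, of m "lex_index (ns k) p"] assms(3) m len by simp
  have C: "core_prod r F m (j # lex_index (ns k) p) $$ (x, 0) =
      (\<Sum>u<r m. F m j $$ (x, u) * ?c F p $$ (u, 0))"
    if "tt_cores r F" "x < r (m - 1)" for F j p x
    using mult_entry[OF tt_coresD[OF that(1)] carr[OF that(1)] that(2), of 0] by simp
  have "right_steps d r n G G' (Suc k) $$ (a, b) = 1 / real (n m) *
      (\<Sum>j<n m. \<Sum>u<r m. \<Sum>v<r m. G m j $$ (a, u) *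
         (1 / real P * (\<Sum>p<P. ?c G p $$ (u, 0) * ?c G' p $$ (v, 0))) * G' m j $$ (b, v))"
    using Suc.IH Suc.prems assms(1-3) ab right_steps_carrier[of r d k n G G']
    by (simp add: transfer_left_entry flip: m_def P_def)
  also have "\<dots> = 1 / real (n m * P) *
      (\<Sum>j<n m. \<Sum>u<r m. \<Sum>v<r m. \<Sum>p<P. (G m j $$ (a, u) * ?c G p $$ (u, 0)) *
         (G' m j $$ (b, v) * ?c G' p $$ (v, 0)))"
    by (simp add: sum_distrib_left sum_distrib_right mult_ac)
  \<comment> \<open>With the grid sum outside both bond sums, the double bond sum factors into two
    core products, each longer by mode \<open>m\<close>.\<close>
  also have "\<dots> = 1 / real (n m * P) *
      (\<Sum>j<n m. \<Sum>p<P. \<Sum>u<r m. \<Sum>v<r m. (G m j $$ (a, u) * ?c G p $$ (u, 0)) *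
         (G' m j $$ (b, v) * ?c G' p $$ (v, 0)))"
    by (simp only: sum.swap[where A = "{..<r m}" and B = "{..<P}"])
  also have "\<dots> = 1 / real (n m * P) *
      (\<Sum>j<n m. \<Sum>p<P. core_prod r G m (j # lex_index (ns k) p) $$ (a, 0) *
         core_prod r G' m (j # lex_index (ns k) p) $$ (b, 0))"
    using assms(1,2) ab by (simp only: C sum_product)
  also have "\<dots> = 1 / real (prod_list (ns (Suc k))) *
      (\<Sum>p<prod_list (ns (Suc k)). core_prod r G m (lex_index (ns (Suc k)) p) $$ (a, 0) *
         core_prod r G' m (lex_index (ns (Suc k)) p) $$ (b, 0))"
    unfolding ns P_def
    by (subst sum_lex_index_Cons[where f = "\<lambda>is. core_prod r G m is $$ (a, 0) * core_prod r G' m is $$ (b, 0)"])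
      simp
  finally show ?case using m by simp
qed

section \<open>Matrix units in products and averages\<close>

text \<open>This is x^T e_a e_b^T y. It evaluates a tensor train whose core at one mode is a matrix
  unit.\<close>

lemma sum_mat_unit:
  assumes "a < p" "b < q"
  shows "(\<Sum>k<p. \<Sum>l<q. x k * mat_unit p q a b $$ (k, l) * y l) = x a * y b"
proof -
  have "(\<Sum>k<p. \<Sum>l<q. x k * mat_unit p q a b $$ (k, l) * y l) =
      (\<Sum>k<p. \<Sum>l<q. (if k = a then if l = b then x k * y l else 0 else 0))"
    using assms by (intro sum.cong) (auto simp: mat_unit_entry)
  also have "\<dots> = (\<Sum>k<p. if k = a then x k * y b else 0)"
    using assms by (intro sum.cong) auto
  also have "\<dots> = x a * y b" using assms by simp
  finally show ?thesis .
qed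

text \<open>From e_b (e_a^T X e_a') e_b'^T, whose middle factor is a scalar.\<close>

lemma mat_unit_sandwich:
  assumes "X \<in> carrier_mat p p'" "a < p" "b < q" "a' < p'" "b' < q'"
  shows "(mat_unit p q a b)\<^sup>T * X * mat_unit p' q' a' b' = X $$ (a, a') \<cdot>\<^sub>m mat_unit q q' b b'"
proof (rule eq_matI)
  fix k l
  assume "k < dim_row (X $$ (a, a') \<cdot>\<^sub>m mat_unit q q' b b')" "l < dim_col (X $$ (a, a') \<cdot>\<^sub>m mat_unit q q' b b')"
  hence kl: "k < q" "l < q'" by auto
  have "((mat_unit p q a b)\<^sup>T * X * mat_unit p' q' a' b') $$ (k, l) =
      (\<Sum>u<p. \<Sum>v<p'. mat_unit p q a b $$ (u, k) * X $$ (u, v) * mat_unit p' q' a' b' $$ (v, l))"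
    using assms kl
    by (subst mult3_entry[of _ q p _ p' _ q']) (auto intro!: sum.cong)
  also have "\<dots> = (\<Sum>u<p. \<Sum>v<p'. (of_bool (u = a) * of_bool (k = b)) * X $$ (u, v) *
      (of_bool (v = a') * of_bool (l = b')))"
    using assms kl by (simp add: mat_unit_entry)
  also have "\<dots> = (\<Sum>u<p. \<Sum>v<p'. if u = a then if v = a' then X $$ (a, a') * of_bool (k = b) * of_bool (l = b') else 0 else 0)"
    using assms by (intro sum.cong) (auto simp: mat_unit_entry)
  also have "\<dots> = (\<Sum>u<p. if u = a then X $$ (a, a') * of_bool (k = b) * of_bool (l = b') else 0)"
    using assms by (intro sum.cong) auto
  also have "\<dots> = X $$ (a, a') * mat_unit q q' b b' $$ (k, l)"
    using assms kl by (simp add: mat_unit_entry)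
  finally show "((mat_unit p q a b)\<^sup>T * X * mat_unit p' q' a' b') $$ (k, l) =
      (X $$ (a, a') \<cdot>\<^sub>m mat_unit q q' b b') $$ (k, l)"
    using kl by auto
qed auto

lemma frobenius_mat_unit:
  assumes "Y \<in> carrier_mat p q" "a < p" "b < q"
  shows "frobenius (c \<cdot>\<^sub>m mat_unit p q a b) Y = c * Y $$ (a, b)"
proof -
  have "frobenius (c \<cdot>\<^sub>m mat_unit p q a b) Y =
      (\<Sum>i<p. \<Sum>j<q. if i = a then if j = b then c * Y $$ (a, b) else 0 else 0)"
    using assms by (auto simp: frobenius_entries[of _ p q] mat_unit_entry intro!: sum.cong)
  also have "\<dots> = (\<Sum>i<p. if i = a then c * Y $$ (a, b) else 0)"
    using assms by (intro sum.cong) auto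
  finally show ?thesis using assms by simp
qed

text \<open>The normalization survives although only one sample contributes; hence the factors 1/n_s
  and 1/n_t in Z_s and Z_t.\<close>

lemma mat_avg_single:
  assumes "i < n" "F i \<in> carrier_mat k k" "\<And>j. j \<noteq> i \<Longrightarrow> F j = 0\<^sub>m k k"
  shows "mat_avg k n F = (1 / real n) \<cdot>\<^sub>m F i"
proof (rule eq_matI)
  fix a b assume "a < dim_row ((1 / real n) \<cdot>\<^sub>m F i)" "b < dim_col ((1 / real n) \<cdot>\<^sub>m F i)"
  hence ab: "a < k" "b < k" using assms(2) by auto
  have "(\<Sum>j<n. F j $$ (a, b)) = (\<Sum>j<n. if j = i then F i $$ (a, b) else 0)"
    using ab assms(3) by (intro sum.cong) auto
  thus "mat_avg k n F $$ (a, b) = ((1 / real n) \<cdot>\<^sub>m F i) $$ (a, b)"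
    using ab assms by (auto simp: mat_avg_def)
qed (use assms(2) in \<open>auto simp: mat_avg_def\<close>)

section \<open>Columns of the direction matrices as tensor trains\<close>

text \<open>The zero matrices encode the Kronecker delta in \<open>Psi\<close>. The result is again
  a family of cores, so everything about transfers and interfaces applies to it.\<close>

definition select_core :: "(nat \<Rightarrow> nat) \<Rightarrow> cores \<Rightarrow> nat \<Rightarrow> nat \<Rightarrow> nat \<Rightarrow> nat \<Rightarrow> cores" where
  "select_core r G s i a b =
     G(s := \<lambda>j. if j = i then mat_unit (r (s - 1)) (r s) a b else 0\<^sub>m (r (s - 1)) (r s))"

lemma tt_cores_select_core:
  assumes "tt_cores r G"
  shows "tt_cores r (select_core r G s i a b)"
  using assms by (auto simp: tt_cores_def select_core_def)

text \<open>Splitting the product at mode \<open>s\<close> gives A * F * B with a row A and a column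
  B. At the active sample the matrix unit F selects \<open>A $$ (0, a) * B $$ (b, 0)\<close>, which
  is the entry of the direction matrix; at other samples F is zero.\<close>

lemma Psi_eq_core_prod:
  assumes "tt_cores r G" "r 0 = 1" "r d = 1" "s \<in> {1..d}"
    and "p < prod_list (grid_dims d n)" "j < n s" "a < r (s - 1)" "b < r s"
  shows "Psi d r n G s $$ (p, lex_pos [n s, r (s - 1), r s] [j, a, b]) =
    core_prod r (select_core r G s j a b) 1 (lex_index (grid_dims d n) p) $$ (0, 0)"
proof -
  define i where "i = lex_index (grid_dims d n) p"
  define i' where "i' = omit s i"
  define F where "F = select_core r G s j a b"
  define A where "A = core_prod r G 1 (take (s - 1) i)"
  define B where "B = core_prod r G (s + 1) (drop s i)"
  have F: "tt_cores r F" using assms(1) by (simp add: F_def tt_cores_select_core)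
  have len: "length i = d" "length (grid_dims d n) = d" by (simp_all add: i_def grid_dims_def)
  have s: "Suc (s - 1) = s" "s \<le> d" "s - 1 < d" using assms(4) by auto
  have box: "list_all2 (<) i (grid_dims d n)"
    using lex_index_box assms(5) by (simp add: i_def)
  hence box': "list_all2 (<) i' (omit s (grid_dims d n))"
    unfolding i'_def omit_def
    by (intro list_all2_appendI list_all2_takeI list_all2_dropI) auto
  \<comment> \<open>Once the entry of mode \<open>s\<close> is removed, the later modes start at
    position \<open>s - 1\<close> instead of \<open>s\<close>.\<close>
  have i': "take (s - 1) i' = take (s - 1) i" "drop (s - 1) i' = drop s i"
    using len s by (simp_all add: i'_def omit_def)
  have A: "A \<in> carrier_mat 1 (r (s - 1))"
    using core_prod_carrier[OF assms(1), of 0 "take (s - 1) i"] assms(2) s len by (simp add: A_def)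
  have B: "B \<in> carrier_mat (r s) 1"
    using core_prod_carrier[OF assms(1), of s "drop s i"] assms(3) s len by (simp add: B_def)
  have cols: "list_all2 (<) [j, a, b] [n s, r (s - 1), r s]" "list_all2 (<) [a, b] [r (s - 1), r s]"
    using assms by auto
  have "direction_mat d r n G s $$ (lex_pos (omit s (grid_dims d n)) i', lex_pos [r (s - 1), r s] [a, b])
      = A $$ (0, a) * B $$ (b, 0)"
    using lex_pos_less[OF box'] lex_pos_less[OF cols(2)] i'
    by (simp add: direction_mat_def lex_index_lex_pos[OF box'] lex_index_lex_pos[OF cols(2)]
        A_def B_def del: One_nat_def lex_pos.simps lex_index.simps)
  moreover have "p < (\<Prod>m=1..d. n m)"
    using assms(5) by (simp add: grid_dims_def atLeastLessThanSuc_atLeastAtMost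
        prod.distinct_set_conv_list[symmetric] del: upt_Suc)
  ultimately have Psi: "Psi d r n G s $$ (p, lex_pos [n s, r (s - 1), r s] [j, a, b]) =
      (if i ! (s - 1) = j then A $$ (0, a) * B $$ (b, 0) else 0)"
    using lex_pos_less[OF cols(1)]
    by (simp add: Psi_def lex_index_lex_pos[OF cols(1)] i_def[symmetric] i'_def[symmetric] mult.assoc
        del: One_nat_def lex_pos.simps lex_index.simps)
  have "i = take (s - 1) i @ i ! (s - 1) # drop s i"
    using id_take_nth_drop[of "s - 1" i] len s by simp
  hence "core_prod r F 1 i = core_prod r F 1 (take (s - 1) i @ i ! (s - 1) # drop s i)" by simp
  also have "\<dots> = core_prod r F 1 (take (s - 1) i) *
      (F s (i ! (s - 1)) * core_prod r F (s + 1) (drop s i))"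
    using core_prod_append[OF F, of 0 "take (s - 1) i" "i ! (s - 1) # drop s i"] len s by simp
  also have "core_prod r F 1 (take (s - 1) i) = A"
    unfolding A_def using s len by (intro core_prod_cong) (auto simp: F_def select_core_def)
  also have "core_prod r F (s + 1) (drop s i) = B"
    unfolding B_def by (intro core_prod_cong) (auto simp: F_def select_core_def)
  also have "A * (F s (i ! (s - 1)) * B) = A * F s (i ! (s - 1)) * B"
    by (rule assoc_mult_mat[OF A tt_coresD[OF F] B, symmetric])
  finally have "core_prod r F 1 i $$ (0, 0) =
      (\<Sum>k<r (s - 1). \<Sum>l<r s. A $$ (0, k) * F s (i ! (s - 1)) $$ (k, l) * B $$ (l, 0))"
    by (simp add: mult3_entry[OF A tt_coresD[OF F] B] del: index_mult_mat(1))
  also have "\<dots> = (if i ! (s - 1) = j then A $$ (0, a) * B $$ (b, 0) else 0)"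
    using sum_mat_unit[OF assms(7,8), of "\<lambda>k. A $$ (0, k)" "\<lambda>l. B $$ (l, 0)"]
    by (simp add: F_def select_core_def)
  finally show ?thesis using Psi by (simp add: i_def F_def)
qed

section \<open>Gramian entries as Frobenius products of interfaces\<close>

lemma Upsilon_carrier:
  "Upsilon d r n G G' s t \<in> carrier_mat (n s * r (s - 1) * r s) (n t * r (t - 1) * r t)"
  by (auto simp: Upsilon_def Psi_def)

text \<open>From (A^T B)^T = B^T A; the two operator terms change places together with the two
  modes.\<close>

lemma Upsilon_transpose: "Upsilon d r n G' G t s = (Upsilon d r n G G' s t)\<^sup>T"
proof -
  have P: "Psi d r n F u \<in> carrier_mat (\<Prod>m=1..d. n m) (n u * r (u - 1) * r u)" for F u
    unfolding Psi_def by simp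
  have "((Psi d r n G s)\<^sup>T * Psi d r n G' t)\<^sup>T = (Psi d r n G' t)\<^sup>T * Psi d r n G s"
    using transpose_mult[OF transpose_carrier_mat[THEN iffD2, OF P[of G s]] P[of G' t]] by simp
  moreover have "(c \<cdot>\<^sub>m A)\<^sup>T = c \<cdot>\<^sub>m A\<^sup>T" for c :: real and A
    by (rule eq_matI) auto
  ultimately show ?thesis by (simp add: Upsilon_def)
qed

text \<open>The bond \<open>k\<close> is left free: any choice gives the same entry, and both kinds
  of blocks use \<open>k = t\<close>, where the right interface is unmodified.\<close>

lemma Upsilon_eq_frobenius:
  assumes "tt_cores r G" "tt_cores r G'" "r 0 = 1" "r d = 1" "s \<in> {1..d}" "t \<in> {1..d}" "k \<le> d"
    and "i < n s" "a < r (s - 1)" "b < r s" "i' < n t" "a' < r (t - 1)" "b' < r t"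
  defines "F \<equiv> select_core r G s i a b" and "F' \<equiv> select_core r G' t i' a' b'"
  shows "Upsilon d r n G G' s t $$
      (lex_pos [n s, r (s - 1), r s] [i, a, b], lex_pos [n t, r (t - 1), r t] [i', a', b']) =
    frobenius (left_steps r n F F' k) (right_steps d r n F F' (d - k))"
proof -
  let ?N = "prod_list (grid_dims d n)"
  let ?c = "lex_pos [n s, r (s - 1), r s] [i, a, b]" and ?c' = "lex_pos [n t, r (t - 1), r t] [i', a', b']"
  have F: "tt_cores r F" "tt_cores r F'"
    using assms by (simp_all add: F_def F'_def tt_cores_select_core)
  have N: "(\<Prod>m=1..d. n m) = ?N"
    by (simp add: grid_dims_def atLeastLessThanSuc_atLeastAtMost
        prod.distinct_set_conv_list[symmetric] del: upt_Suc)
  have c: "?c < n s * r (s - 1) * r s" "?c' < n t * r (t - 1) * r t"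
    using lex_pos_less[of "[i, a, b]" "[n s, r (s - 1), r s]"]
      lex_pos_less[of "[i', a', b']" "[n t, r (t - 1), r t]"] assms by (simp_all add: mult.assoc)
  have P: "Psi d r n G u \<in> carrier_mat ?N (n u * r (u - 1) * r u)" for G u
    unfolding Psi_def N by simp
  have "Upsilon d r n G G' s t $$ (?c, ?c') = 1 / real ?N * ((Psi d r n G s)\<^sup>T * Psi d r n G' t) $$ (?c, ?c')"
    using c P[of G s] P[of G' t] unfolding Upsilon_def N
    by (subst index_smult_mat(1)) (auto simp del: index_mult_mat(1) lex_pos.simps)
  also have "((Psi d r n G s)\<^sup>T * Psi d r n G' t) $$ (?c, ?c') =
      (\<Sum>p<?N. Psi d r n G s $$ (p, ?c) * Psi d r n G' t $$ (p, ?c'))"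
    using c P[of G s] P[of G' t]
    by (subst mult_entry[of _ "n s * r (s - 1) * r s" ?N _ "n t * r (t - 1) * r t"])
      (auto simp del: lex_pos.simps intro!: sum.cong)
  also have "\<dots> = (\<Sum>p<?N. core_prod r F 1 (lex_index (grid_dims d n) p) $$ (0, 0) *
      core_prod r F' 1 (lex_index (grid_dims d n) p) $$ (0, 0))"
    using assms by (intro sum.cong refl arg_cong2[where f = "(*)"]) (simp_all only: Psi_eq_core_prod lessThan_iff)
  \<comment> \<open>With all \<open>d\<close> modes absorbed the interface is 1 by 1, and its entry
    is the mean over the full grid.\<close>
  also have "1 / real ?N * \<dots> = right_steps d r n F F' d $$ (0, 0)"
    using right_steps_entry[OF F assms(4), of d 0 0 n] assms(3)
    by (simp add: grid_dims_def del: upt_Suc)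
  finally show ?thesis using frobenius_interfaces[OF F assms(3,4,7)] by simp
qed

section \<open>Interfaces of the modified cores\<close>

text \<open>Up to mode \<open>s - 1\<close> the recursion is the original one, and at mode
  \<open>s\<close> one sample survives. The family \<open>G'\<close> is arbitrary so that it may
  itself be modified, at mode \<open>s\<close> or at a later one.\<close>

lemma left_steps_select_left:
  assumes "tt_cores r G" "tt_cores r G'" "r 0 = 1" "s > 0" "i < n s"
  shows "left_steps r n (select_core r G s i a b) G' s =
    (1 / real (n s)) \<cdot>\<^sub>m ((mat_unit (r (s - 1)) (r s) a b)\<^sup>T * L_lt r n G G' s * G' s i)"
proof -
  let ?F = "select_core r G s i a b"
  note L = L_lt_carrier[of r n G G' s, OF assms(3)]
  have "left_steps r n ?F G' (s - 1) = L_lt r n G G' s"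
    unfolding L_lt_def using assms(4) by (intro left_steps_cong) (auto simp: select_core_def)
  hence "left_steps r n ?F G' s = transfer_right r n ?F G' s (L_lt r n G G' s)"
    using assms(4) by (cases s) auto
  also have "\<dots> = (1 / real (n s)) \<cdot>\<^sub>m ((?F s i)\<^sup>T * L_lt r n G G' s * G' s i)"
    unfolding transfer_right_def using L carrier_matD[OF tt_coresD[OF assms(2)], of s]
    by (intro mat_avg_single assms(5)) (auto simp: select_core_def simp del: One_nat_def)
  finally show ?thesis by (simp add: select_core_def)
qed

text \<open>The closing step of the recursion, which turns Z_(t-1) into Z_t.\<close>

lemma transfer_right_select_right:
  assumes "tt_cores r G" "tt_cores r G'" "X \<in> carrier_mat (r (t - 1)) (r (t - 1))" "i < n t"
  shows "transfer_right r n G (select_core r G' t i a b) t X =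
    (1 / real (n t)) \<cdot>\<^sub>m ((G t i)\<^sup>T * X * mat_unit (r (t - 1)) (r t) a b)"
proof -
  let ?F = "select_core r G' t i a b"
  have "transfer_right r n G ?F t X = (1 / real (n t)) \<cdot>\<^sub>m ((G t i)\<^sup>T * X * ?F t i)"
    unfolding transfer_right_def using assms(3) carrier_matD[OF tt_coresD[OF assms(1)], of t]
    by (intro mat_avg_single assms(4)) (auto simp: select_core_def simp del: One_nat_def)
  thus ?thesis by (simp add: select_core_def)
qed

lemma R_gt_select:
  assumes "s \<le> t" "t \<le> d" "s' \<le> t"
  shows "right_steps d r n (select_core r G s i a b) (select_core r G' s' i' a' b') (d - t) =
    R_gt d r n G G' t"
  unfolding R_gt_def using assms by (intro right_steps_cong) (auto simp: select_core_def)

section \<open>Diagonal blocks\<close>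

text \<open>With both modifications at mode \<open>s\<close>, the left interface after
  \<open>s\<close> is a multiple of the matrix unit at \<open>(b, b')\<close>, and pairing it with
  the right interface reads off one entry.\<close>

lemma Upsilon_diagonal_entry:
  assumes "tt_cores r G" "tt_cores r G'" "r 0 = 1" "r d = 1" "s \<in> {1..d}"
    and "i < n s" "a < r (s - 1)" "b < r s" "i' < n s" "a' < r (s - 1)" "b' < r s"
  shows "Upsilon d r n G G' s s $$
      (lex_pos [n s, r (s - 1), r s] [i, a, b], lex_pos [n s, r (s - 1), r s] [i', a', b']) =
    1 / real (n s) * of_bool (i = i') * (L_lt r n G G' s $$ (a, a') * R_gt d r n G G' s $$ (b, b'))"
proof -
  let ?F = "select_core r G s i a b" and ?F' = "select_core r G' s i' a' b'"
  let ?M = "mat_unit (r (s - 1)) (r s)"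
  note L = L_lt_carrier[of r n G G' s, OF assms(3)]
  have R: "R_gt d r n G G' s \<in> carrier_mat (r s) (r s)"
    using R_gt_carrier[of r d s n G G'] assms(4,5) by simp
  \<comment> \<open>The second family is already modified at \<open>s\<close>, but this interface
    absorbs only the modes below \<open>s\<close>.\<close>
  have "L_lt r n G ?F' s = L_lt r n G G' s"
    unfolding L_lt_def using assms(5) by (intro left_steps_cong) (auto simp: select_core_def)
  hence "left_steps r n ?F ?F' s = (1 / real (n s)) \<cdot>\<^sub>m ((?M a b)\<^sup>T * L_lt r n G G' s * ?F' s i)"
    using assms by (simp add: left_steps_select_left tt_cores_select_core)
  also have "(?M a b)\<^sup>T * L_lt r n G G' s * ?F' s i =
      (of_bool (i = i') * L_lt r n G G' s $$ (a, a')) \<cdot>\<^sub>m mat_unit (r s) (r s) b b'"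
  proof (cases "i = i'")
    case True
    thus ?thesis using mat_unit_sandwich[OF L assms(7,8,10,11)] by (simp add: select_core_def)
  next
    \<comment> \<open>Here the second modified core is zero at sample \<open>i\<close>.\<close>
    case False
    thus ?thesis using L by (auto simp: select_core_def intro!: eq_matI)
  qed
  finally have "left_steps r n ?F ?F' s =
      (1 / real (n s) * (of_bool (i = i') * L_lt r n G G' s $$ (a, a'))) \<cdot>\<^sub>m mat_unit (r s) (r s) b b'"
    by (auto intro!: eq_matI)
  thus ?thesis
    using assms Upsilon_eq_frobenius[OF assms(1-5,5), of s i n a b i' a' b'] R
    by (simp add: R_gt_select frobenius_mat_unit del: lex_pos.simps)
qed

text \<open>Allows an equality of matrices to be checked on multi-indices instead of
  positions.\<close>

lemma lex_pos_exhaust3: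
  assumes "p < k * l * m"
  obtains i a b where "i < k" "a < l" "b < m" "p = lex_pos [k, l, m] [i, a, b]"
proof -
  have "p < prod_list [k, l, m]" using assms by (simp add: mult.assoc)
  note box = lex_index_box[OF this] lex_pos_lex_index[OF this]
  show thesis
    using box that[of "lex_index [k, l, m] p ! 0" "lex_index [k, l, m] p ! 1" "lex_index [k, l, m] p ! 2"]
    by simp
qed

text \<open>The position of a triple is that of its first index paired with the position of the
  other two, so the two-factor formula applies twice.\<close>

lemma kronecker3_entry:
  assumes "A \<in> carrier_mat k k" "B \<in> carrier_mat l l" "C \<in> carrier_mat m m"
    and "i < k" "a < l" "b < m" "i' < k" "a' < l" "b' < m"
  shows "kronecker A (kronecker B C) $$ (lex_pos [k, l, m] [i, a, b], lex_pos [k, l, m] [i', a', b']) =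
    A $$ (i, i') * (B $$ (a, a') * C $$ (b, b'))"
proof -
  have BC: "dim_row (kronecker B C) = l * m" "dim_col (kronecker B C) = l * m"
    using assms by (simp_all add: kronecker_def)
  have pos: "lex_pos [k, l, m] [x, y, w] = lex_pos [k, l * m] [x, lex_pos [l, m] [y, w]]" for x y w
    by simp
  have less: "lex_pos [l, m] [a, b] < l * m" "lex_pos [l, m] [a', b'] < l * m"
    using lex_pos_less[of "[a, b]" "[l, m]"] lex_pos_less[of "[a', b']" "[l, m]"] assms by simp_all
  show ?thesis
    using kronecker_entry[of i A "lex_pos [l, m] [a, b]" "kronecker B C" i' "lex_pos [l, m] [a', b']"]
      kronecker_entry[of a B b C a' b'] assms BC less
    unfolding pos by (simp del: lex_pos.simps)
qed

lemma Upsilon_diagonal: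
  assumes "tt_cores r G" "tt_cores r G'" "r 0 = 1" "r d = 1" "s \<in> {1..d}"
  shows "Upsilon d r n G G' s s =
    kronecker ((1 / real (n s)) \<cdot>\<^sub>m 1\<^sub>m (n s)) (kronecker (L_lt r n G G' s) (R_gt d r n G G' s))"
    (is "?U = ?K")
proof (rule eq_matI)
  note L = L_lt_carrier[of r n G G' s, OF assms(3)]
  have R: "R_gt d r n G G' s \<in> carrier_mat (r s) (r s)"
    using R_gt_carrier[of r d s n G G'] assms(4,5) by simp
  have dim: "dim_row ?K = n s * r (s - 1) * r s" "dim_col ?K = n s * r (s - 1) * r s"
    using L R by (simp_all add: kronecker_def)
  thus "dim_row ?U = dim_row ?K" "dim_col ?U = dim_col ?K"
    using Upsilon_carrier[of d r n G G' s s] by auto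
  fix p q assume "p < dim_row ?K" "q < dim_col ?K"
  then obtain i a b i' a' b'
    where "i < n s" "a < r (s - 1)" "b < r s" "p = lex_pos [n s, r (s - 1), r s] [i, a, b]"
      "i' < n s" "a' < r (s - 1)" "b' < r s" "q = lex_pos [n s, r (s - 1), r s] [i', a', b']"
    unfolding dim by (metis lex_pos_exhaust3)
  thus "?U $$ (p, q) = ?K $$ (p, q)"
    using Upsilon_diagonal_entry[OF assms, of i n a b i' a' b']
      kronecker3_entry[OF _ L R, of "(1 / real (n s)) \<cdot>\<^sub>m 1\<^sub>m (n s)" "n s" i a b i' a' b']
    by (simp del: lex_pos.simps)
qed

section \<open>Off-diagonal blocks\<close>

text \<open>The sequence \<open>Z\<close> is the left recursion of the modified cores from bond
  \<open>s\<close> to bond \<open>t\<close>: it starts with the matrix unit in the first family and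
  ends with the one in the second.\<close>

lemma Upsilon_off_diagonal:
  assumes "tt_cores r G" "tt_cores r G'" "r 0 = 1" "r d = 1" "s \<in> {1..d}" "t \<in> {1..d}" "s < t"
    and "i < n s" "a < r (s - 1)" "b < r s" "i' < n t" "a' < r (t - 1)" "b' < r t"
    and Zs: "Z s = (1 / real (n s)) \<cdot>\<^sub>m ((mat_unit (r (s - 1)) (r s) a b)\<^sup>T * L_lt r n G G' s * G' s i)"
    and Zm: "\<And>m. s < m \<Longrightarrow> m < t \<Longrightarrow> Z m = transfer_right r n G G' m (Z (m - 1))"
    and Zt: "Z t = (1 / real (n t)) \<cdot>\<^sub>m ((G t i')\<^sup>T * Z (t - 1) * mat_unit (r (t - 1)) (r t) a' b')"
  shows "\<forall>m\<in>{s..t}. Z m \<in> carrier_mat (r m) (r m)"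
    and "Upsilon d r n G G' s t $$
        (lex_pos [n s, r (s - 1), r s] [i, a, b], lex_pos [n t, r (t - 1), r t] [i', a', b']) =
      frobenius (Z t) (R_gt d r n G G' t)"
proof -
  let ?F = "select_core r G s i a b" and ?F' = "select_core r G' t i' a' b'"
  have F: "tt_cores r ?F" "tt_cores r ?F'" using assms by (simp_all add: tt_cores_select_core)
  have LF: "L_lt r n G ?F' s = L_lt r n G G' s"
    unfolding L_lt_def using assms(7) by (intro left_steps_cong) (auto simp: select_core_def)
  have F's: "?F' s i = G' s i" using assms(7) by (simp add: select_core_def)
  \<comment> \<open>Below \<open>t\<close> the second family is the original one, so the ordinary
    transfers apply; the last step is different and is treated separately.\<close>
  have Z: "m < t \<longrightarrow> Z m = left_steps r n ?F ?F' m" if "s \<le> m" for m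
    using that
  proof (induction m rule: dec_induct)
    case base
    show ?case
      using left_steps_select_left[OF assms(1) F(2) assms(3), of s i n a b] assms(5,8) Zs LF F's by simp
  next
    case (step m)
    have "?F (Suc m) = G (Suc m)" "Suc m < t \<Longrightarrow> ?F' (Suc m) = G' (Suc m)"
      using step by (auto simp: select_core_def)
    thus ?case using step Zm[of "Suc m"] by (auto simp: transfer_right_def)
  qed
  \<comment> \<open>For \<open>t = s + 1\<close> this is \<open>Z s\<close> itself, with no middle
    step.\<close>
  have Z1: "Z (t - 1) = left_steps r n ?F ?F' (t - 1)" using Z[of "t - 1"] assms(7) by simp
  have Ft: "?F t = G t" using assms(7) by (simp add: select_core_def)
  have "left_steps r n ?F ?F' t = transfer_right r n ?F ?F' t (Z (t - 1))"
    using assms(7) Z1 by (cases t) auto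
  also have "\<dots> = Z t"
    using transfer_right_select_right[OF F(1) assms(2), of "Z (t - 1)" t i' n a' b']
      left_steps_carrier[of r n ?F ?F' "t - 1", OF assms(3)] Zt Z1 Ft assms(11) by simp
  finally have Zt': "left_steps r n ?F ?F' t = Z t" .
  show "\<forall>m\<in>{s..t}. Z m \<in> carrier_mat (r m) (r m)"
  proof
    fix m assume "m \<in> {s..t}"
    hence "Z m = left_steps r n ?F ?F' m" using Z Zt' by (cases "m = t") auto
    thus "Z m \<in> carrier_mat (r m) (r m)" using left_steps_carrier[of r] assms(3) by simp
  qed
  show "Upsilon d r n G G' s t $$
        (lex_pos [n s, r (s - 1), r s] [i, a, b], lex_pos [n t, r (t - 1), r t] [i', a', b']) =
      frobenius (Z t) (R_gt d r n G G' t)"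
    using assms(5-13) Upsilon_eq_frobenius[OF assms(1-6), of t i n a b i' a' b'] Zt'
    by (simp add: R_gt_select del: lex_pos.simps)
qed

theorem theorem4p6:
  fixes d R\<^sub>A :: nat
    and r n :: "nat \<Rightarrow> nat"
    and D :: "nat \<Rightarrow> real set"
    and H :: "nat \<Rightarrow> 'h::real_inner set"
    and emb :: "nat \<Rightarrow> 'h \<Rightarrow> real \<Rightarrow> real"
    and Op :: "nat \<Rightarrow> nat \<Rightarrow> 'h \<Rightarrow> real \<Rightarrow> real"
    and core :: "nat \<Rightarrow> nat \<Rightarrow> nat \<Rightarrow> 'h"
    and z :: "nat \<Rightarrow> nat \<Rightarrow> real"
    and G :: "nat \<Rightarrow> nat \<Rightarrow> nat \<Rightarrow> real mat"
    and \<beta> \<gamma> :: nat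
  assumes "d \<ge> 1"
    and "r 0 = 1" and "r d = 1" and "\<forall>m\<le>d. r m \<ge> 1"
    and "\<forall>m\<in>{1..d}. \<exists>a b. a < b \<and> D m = {a<..<b}"
    and "\<forall>m\<in>{1..d}. subspace (H m) \<and> complete (H m) \<and> L2_embedding (H m) (D m) (emb m)"
    and "\<forall>\<beta>\<in>{1..R\<^sub>A}. \<forall>m\<in>{1..d}. bounded_linear_L2 (H m) (D m) (Op \<beta> m)"
    and "\<forall>m\<in>{1..d}. \<forall>a<r (m - 1). \<forall>b<r m. core m a b \<in> H m"
    and "\<forall>\<beta>\<in>{1..R\<^sub>A}. \<forall>m\<in>{1..d}. \<forall>a<r (m - 1). \<forall>b<r m. \<exists>g. is_cont_rep (D m) (Op \<beta> m (core m a b)) g"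
    and "\<forall>m\<in>{1..d}. n m \<ge> 1 \<and> (\<forall>i<n m. z m i \<in> D m)"
    and "G = sampled_core r D Op core z"
    and "\<beta> \<in> {1..R\<^sub>A}" and "\<gamma> \<in> {1..R\<^sub>A}"
  shows
    "(\<forall>s\<in>{1..d}.
        Upsilon d r n (G \<beta>) (G \<gamma>) s s \<in> carrier_mat (n s * r (s - 1) * r s) (n s * r (s - 1) * r s) \<and>
        Upsilon d r n (G \<beta>) (G \<gamma>) s s =
          kronecker ((1 / real (n s)) \<cdot>\<^sub>m 1\<^sub>m (n s))
            (kronecker (L_lt r n (G \<beta>) (G \<gamma>) s) (R_gt d r n (G \<beta>) (G \<gamma>) s)))
     \<and>
     (\<forall>s\<in>{1..d}. \<forall>t\<in>{1..d}. s < t \<longrightarrow>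
        Upsilon d r n (G \<beta>) (G \<gamma>) s t \<in> carrier_mat (n s * r (s - 1) * r s) (n t * r (t - 1) * r t) \<and>
        (\<forall>i\<^sub>s<n s. \<forall>i\<^sub>t<n t. \<forall>a<r (s - 1). \<forall>b<r s. \<forall>a'<r (t - 1). \<forall>b'<r t.
          \<forall>Z :: nat \<Rightarrow> real mat.
            Z s = (1 / real (n s)) \<cdot>\<^sub>m
                    ((mat_unit (r (s - 1)) (r s) a b)\<^sup>T * L_lt r n (G \<beta>) (G \<gamma>) s * G \<gamma> s i\<^sub>s) \<longrightarrow>
            (\<forall>m. s < m \<and> m < t \<longrightarrow> Z m = transfer_right r n (G \<beta>) (G \<gamma>) m (Z (m - 1))) \<longrightarrow>
            Z t = (1 / real (n t)) \<cdot>\<^sub>m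
                    ((G \<beta> t i\<^sub>t)\<^sup>T * Z (t - 1) * mat_unit (r (t - 1)) (r t) a' b') \<longrightarrow>
            (\<forall>m\<in>{s..t}. Z m \<in> carrier_mat (r m) (r m)) \<and>
            Upsilon d r n (G \<beta>) (G \<gamma>) s t $$
                (lex_pos [n s, r (s - 1), r s] [i\<^sub>s, a, b], lex_pos [n t, r (t - 1), r t] [i\<^sub>t, a', b'])
              = frobenius (Z t) (R_gt d r n (G \<beta>) (G \<gamma>) t)) \<and>
        Upsilon d r n (G \<gamma>) (G \<beta>) t s = (Upsilon d r n (G \<beta>) (G \<gamma>) s t)\<^sup>T)"
proof (intro conjI ballI impI allI)
  have G: "tt_cores r (G \<beta>)" for \<beta>
    using assms(11) by (simp add: tt_cores_def sampled_core_def)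
  show "Upsilon d r n (G \<beta>) (G \<gamma>) s s =
      kronecker ((1 / real (n s)) \<cdot>\<^sub>m 1\<^sub>m (n s))
        (kronecker (L_lt r n (G \<beta>) (G \<gamma>) s) (R_gt d r n (G \<beta>) (G \<gamma>) s))" if "s \<in> {1..d}" for s
    by (rule Upsilon_diagonal[OF G G assms(2,3) that])
  fix s t i\<^sub>s i\<^sub>t a b a' b' and Z :: "nat \<Rightarrow> real mat"
  assume idx: "s \<in> {1..d}" "t \<in> {1..d}" "s < t" "i\<^sub>s < n s" "i\<^sub>t < n t"
      "a < r (s - 1)" "b < r s" "a' < r (t - 1)" "b' < r t"
    and Z: "Z s = (1 / real (n s)) \<cdot>\<^sub>m
        ((mat_unit (r (s - 1)) (r s) a b)\<^sup>T * L_lt r n (G \<beta>) (G \<gamma>) s * G \<gamma> s i\<^sub>s)"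
      "\<forall>m. s < m \<and> m < t \<longrightarrow> Z m = transfer_right r n (G \<beta>) (G \<gamma>) m (Z (m - 1))"
      "Z t = (1 / real (n t)) \<cdot>\<^sub>m
        ((G \<beta> t i\<^sub>t)\<^sup>T * Z (t - 1) * mat_unit (r (t - 1)) (r t) a' b')"
  note off = Upsilon_off_diagonal[OF G G assms(2,3) idx(1-4,6,7,5,8,9) Z(1) Z(2)[rule_format] Z(3)]
  show "Upsilon d r n (G \<beta>) (G \<gamma>) s t $$
      (lex_pos [n s, r (s - 1), r s] [i\<^sub>s, a, b], lex_pos [n t, r (t - 1), r t] [i\<^sub>t, a', b']) =
    frobenius (Z t) (R_gt d r n (G \<beta>) (G \<gamma>) t)"
    by (rule off(2)) simp_all
  show "Z m \<in> carrier_mat (r m) (r m)" if "m \<in> {s..t}" for m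
    using off(1) that by blast
\<comment> \<open>What remains are the dimensions of the blocks and the opposite block.\<close>
qed (rule Upsilon_carrier Upsilon_transpose)+

end
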